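(* Let $T$ be the $d$-adic tree and let $G\le\operatorname{Aut}T$ be a self-similar group. Let $S\subseteq G$ and $K=\langle S\rangle^G$, and let $N\trianglelefteq G$. If $K\subseteq\operatorname{st}_G(L_n)$ for some $n\in\mathbb{N}$ and $\psi_u(S)\subseteq N$ for each $u\in L_n$, then $\psi_u(K)\subseteq N$ for each $u\in L_n$.
   Context: The vertices of the $d$-adic tree $T$ are the words in the free monoid $X^*$, $|X|=d$; the root is the empty word, and $u$ is joined to $ux$ for $x\in X$. $L_n$ is the set of words of length $n$. $\operatorname{Aut}T$ is the group of automorphisms of the rooted tree $T$, with product $(fg)(u)=g(f(u))$. For $g\in\operatorname{Aut}T$ and a vertex $u$, the section $g_u\in\operatorname{Aut}T$ is defined by $g(uv)=g(u)g_u(v)$ for all $v\in X^*$. $\operatorname{st}_G(L_n)$ is the subgroup of elements of $G$ fixing every vertex of $L_n$, and $\psi_u$ is the homomorphism $g\mapsto g_u$ defined on the stabilizer of $u$. $G$ is self-similar if $g_u\in G$ for all $g\in G$ and all vertices $u$. $\langle S\rangle^G$ denotes the normal closure of $S$ in $G$. *)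

theory Defs
  imports "HOL-Algebra.Algebra"
begin

text \<open>
  The alphabet \<open>X\<close> is a finite type \<open>'x\<close>, so \<open>d = CARD('x)\<close>, and the vertices of the
  \<open>d\<close>-adic tree are the words \<open>'x list\<close>.
\<close>

definition adjacent :: "'x list \<Rightarrow> 'x list \<Rightarrow> bool" where
  "adjacent u v \<longleftrightarrow> (\<exists>x. v = u @ [x] \<or> u = v @ [x])"

definition level :: "nat \<Rightarrow> 'x list set" where
  "level n = {u. length u = n}"

definition tree_auts :: "('x list \<Rightarrow> 'x list) set" where
  "tree_auts = {g. bij g \<and> g [] = [] \<and> (\<forall>u v. adjacent (g u) (g v) \<longleftrightarrow> adjacent u v)}"

text \<open>Automorphisms act on the right: the product \<open>f g\<close> is \<open>f\<close> first, then \<open>g\<close>.\<close>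

definition AutT :: "('x list \<Rightarrow> 'x list) monoid" where
  "AutT = \<lparr>carrier = tree_auts, monoid.mult = (\<lambda>f g. \<lambda>u. g (f u)), one = (\<lambda>u. u)\<rparr>"

text \<open>
  Existence and uniqueness of the section are established in \<open>section_at_spec\<close> and
  \<open>section_at_unique\<close> below.
\<close>

definition section_at :: "('x list \<Rightarrow> 'x list) \<Rightarrow> 'x list \<Rightarrow> ('x list \<Rightarrow> 'x list)" where
  "section_at g u = (THE h. h \<in> carrier AutT \<and> (\<forall>v. g (u @ v) = g u @ h v))"

definition vertex_stabilizer :: "'x list \<Rightarrow> ('x list \<Rightarrow> 'x list) set" where
  "vertex_stabilizer u = {g \<in> carrier AutT. g u = u}"

definition level_stabilizer :: "('x list \<Rightarrow> 'x list) set \<Rightarrow> nat \<Rightarrow> ('x list \<Rightarrow> 'x list) set" where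
  "level_stabilizer G n = {g \<in> G. \<forall>u \<in> level n. g u = u}"

definition psi :: "'x list \<Rightarrow> ('x list \<Rightarrow> 'x list) \<Rightarrow> ('x list \<Rightarrow> 'x list)" where
  "psi u = (\<lambda>g \<in> vertex_stabilizer u. section_at g u)"

definition self_similar :: "('x list \<Rightarrow> 'x list) set \<Rightarrow> bool" where
  "self_similar G \<longleftrightarrow> (\<forall>g \<in> G. \<forall>u. section_at g u \<in> G)"

definition normal_closure :: "('a, 'b) monoid_scheme \<Rightarrow> 'a set \<Rightarrow> 'a set" where
  "normal_closure G S = \<Inter> {N. N \<lhd> G \<and> S \<subseteq> N}"


lemma tree_auts_child:
  assumes g: "g \<in> tree_auts"
  shows "\<exists>y. g (u @ [x]) = g u @ [y]"
proof (induction u arbitrary: x rule: rev_induct)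
  case Nil
  have "adjacent ([] :: 'a list) [x]"
    by (simp add: adjacent_def)
  then have "adjacent (g []) (g [x])"
    using g unfolding tree_auts_def by blast
  then show ?case
    using g by (auto simp: tree_auts_def adjacent_def)
next
  case (snoc z w)
  obtain y where y: "g (w @ [z]) = g w @ [y]"
    using snoc.IH by blast
  have "adjacent (w @ [z]) ((w @ [z]) @ [x])"
    unfolding adjacent_def by blast
  then have "adjacent (g (w @ [z])) (g ((w @ [z]) @ [x]))"
    using g unfolding tree_auts_def by blast
  then consider a where "g ((w @ [z]) @ [x]) = g (w @ [z]) @ [a]"
    | a where "g (w @ [z]) = g ((w @ [z]) @ [x]) @ [a]"
    unfolding adjacent_def by blast
  then show ?case
  proof cases
    case 1
    then show ?thesis by blast
  next
    case 2
    then have "g w = g ((w @ [z]) @ [x])"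
      using y by simp
    moreover have "inj g"
      using g by (simp add: tree_auts_def bij_def)
    ultimately have "w = (w @ [z]) @ [x]"
      by (blast dest: injD)
    then show ?thesis by simp
  qed
qed

lemma tree_auts_append:
  assumes g: "g \<in> tree_auts"
  shows "\<exists>w. length w = length v \<and> g (u @ v) = g u @ w"
proof (induction v rule: rev_induct)
  case Nil
  then show ?case by simp
next
  case (snoc x v)
  then obtain w where "length w = length v" "g (u @ v) = g u @ w" by blast
  moreover obtain y where "g ((u @ v) @ [x]) = g (u @ v) @ [y]"
    using tree_auts_child[OF g] by blast
  ultimately have "length (w @ [y]) = length (v @ [x]) \<and> g (u @ v @ [x]) = g u @ (w @ [y])"
    by simp
  then show ?case by blast
qed

lemma tree_auts_length:
  "g \<in> tree_auts \<Longrightarrow> length (g u) = length u"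
  using tree_auts_append[of g u "[]"] by (auto simp: tree_auts_def)

lemma tree_auts_inv:
  assumes g: "g \<in> tree_auts"
  shows "inv_into UNIV g \<in> tree_auts"
proof -
  have b: "bij g" and r: "g [] = []"
    and a: "\<And>u v. adjacent (g u) (g v) \<longleftrightarrow> adjacent u v"
    using g by (auto simp: tree_auts_def)
  have "adjacent (inv_into UNIV g u) (inv_into UNIV g v) \<longleftrightarrow> adjacent u v" for u v
    using a[of "inv_into UNIV g u" "inv_into UNIV g v"] b
    by (simp add: bij_is_surj surj_f_inv_f)
  moreover have "inv_into UNIV g [] = []"
    using b r by (metis bij_inv_eq_iff)
  ultimately show ?thesis
    using b by (simp add: tree_auts_def bij_imp_bij_inv)
qed

lemma AutT_group: "group AutT"
proof (rule groupI)
  fix f g :: "'x list \<Rightarrow> 'x list"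
  assume "f \<in> carrier AutT" "g \<in> carrier AutT"
  then show "f \<otimes>\<^bsub>AutT\<^esub> g \<in> carrier AutT"
    using bij_comp[of f g] by (simp add: AutT_def tree_auts_def comp_def)
next
  fix f :: "'x list \<Rightarrow> 'x list"
  assume f: "f \<in> carrier AutT"
  then have "inv_into UNIV f \<in> carrier AutT"
    by (simp add: AutT_def tree_auts_inv)
  moreover have "inv_into UNIV f \<otimes>\<^bsub>AutT\<^esub> f = \<one>\<^bsub>AutT\<^esub>"
    using f by (auto simp: AutT_def tree_auts_def bij_is_surj surj_f_inv_f)
  ultimately show "\<exists>h \<in> carrier AutT. h \<otimes>\<^bsub>AutT\<^esub> f = \<one>\<^bsub>AutT\<^esub>" by blast
qed (auto simp: AutT_def tree_auts_def bij_def)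

lemma section_exists:
  assumes "g \<in> carrier AutT"
  shows "\<exists>h \<in> carrier AutT. \<forall>v. g (u @ v) = g u @ h v"
proof -
  have g: "g \<in> tree_auts"
    using assms by (simp add: AutT_def)
  have b: "bij g" and a: "\<And>v w. adjacent (g v) (g w) \<longleftrightarrow> adjacent v w"
    using g by (auto simp: tree_auts_def)
  define h where "h v = drop (length u) (g (u @ v))" for v
  have h: "g (u @ v) = g u @ h v" for v
    using tree_auts_append[OF g, of v u] tree_auts_length[OF g, of u]
    by (auto simp: h_def)
  have "inj h"
  proof (rule injI)
    fix v w assume "h v = h w"
    then have "g (u @ v) = g (u @ w)" using h by simp
    then show "v = w" using b by (auto dest: injD simp: bij_def)
  qed
  moreover have "surj h"
  proof (rule surjI)
    fix w
    have i: "inv_into UNIV g \<in> tree_auts" by (rule tree_auts_inv[OF g])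
    have "inv_into UNIV g (g u) = u" using b by (simp add: bij_is_inj)
    then obtain v where "inv_into UNIV g (g u @ w) = u @ v"
      using tree_auts_append[OF i, of w "g u"] by auto
    then have "g (u @ v) = g u @ w" using b by (metis bij_inv_eq_iff)
    then show "h (drop (length u) (inv_into UNIV g (g u @ w))) = w"
      using h \<open>inv_into UNIV g (g u @ w) = u @ v\<close> by simp
  qed
  moreover have "h [] = []"
    using h[of "[]"] by simp
  moreover have "adjacent (h v) (h w) \<longleftrightarrow> adjacent v w" for v w
    using a[of "u @ v" "u @ w"] by (simp add: h adjacent_def)
  ultimately have "h \<in> carrier AutT"
    by (simp add: AutT_def tree_auts_def bij_def)
  then show ?thesis using h by blast
qed

lemma section_at_unique:
  assumes "h \<in> carrier AutT" and "\<And>v. g (u @ v) = g u @ h v"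
  shows "section_at g u = h"
  unfolding section_at_def
proof (rule the_equality)
  show "h \<in> carrier AutT \<and> (\<forall>v. g (u @ v) = g u @ h v)"
    using assms by blast
  show "h' = h" if "h' \<in> carrier AutT \<and> (\<forall>v. g (u @ v) = g u @ h' v)" for h'
    using that assms(2) by (metis same_append_eq ext)
qed

lemma section_at_spec:
  assumes "g \<in> carrier AutT"
  shows "section_at g u \<in> carrier AutT" and "g (u @ v) = g u @ section_at g u v"
proof -
  obtain h where h: "h \<in> carrier AutT" "\<And>v. g (u @ v) = g u @ h v"
    using section_exists[OF assms] by blast
  then show "section_at g u \<in> carrier AutT" and "g (u @ v) = g u @ section_at g u v"
    using section_at_unique[OF h] by auto
qed

lemma section_at_mult:
  assumes f: "f \<in> carrier AutT" and g: "g \<in> carrier AutT"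
  shows "section_at (f \<otimes>\<^bsub>AutT\<^esub> g) u = section_at f u \<otimes>\<^bsub>AutT\<^esub> section_at g (f u)"
proof (rule section_at_unique)
  show "section_at f u \<otimes>\<^bsub>AutT\<^esub> section_at g (f u) \<in> carrier AutT"
    using f g by (intro monoid.m_closed[OF group.is_monoid[OF AutT_group]] section_at_spec)
  show "(f \<otimes>\<^bsub>AutT\<^esub> g) (u @ v) =
      (f \<otimes>\<^bsub>AutT\<^esub> g) u @ (section_at f u \<otimes>\<^bsub>AutT\<^esub> section_at g (f u)) v" for v
    by (simp add: AutT_def) (metis f g section_at_spec(2))
qed

lemma psi_hom: "psi u \<in> hom (AutT\<lparr>carrier := vertex_stabilizer u\<rparr>) AutT"
proof (rule homI)
  fix f assume "f \<in> carrier (AutT\<lparr>carrier := vertex_stabilizer u\<rparr>)"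
  then show "psi u f \<in> carrier AutT"
    by (simp add: psi_def vertex_stabilizer_def section_at_spec(1))
next
  fix f g
  assume "f \<in> carrier (AutT\<lparr>carrier := vertex_stabilizer u\<rparr>)"
    and "g \<in> carrier (AutT\<lparr>carrier := vertex_stabilizer u\<rparr>)"
  then have fg: "f \<in> carrier AutT" "f u = u" "g \<in> carrier AutT" "g u = u"
    by (auto simp: vertex_stabilizer_def)
  have "f \<otimes>\<^bsub>AutT\<^esub> g \<in> carrier AutT"
    using fg by (intro monoid.m_closed[OF group.is_monoid[OF AutT_group]])
  moreover have "(f \<otimes>\<^bsub>AutT\<^esub> g) u = u"
    using fg by (simp add: AutT_def)
  ultimately show "psi u (f \<otimes>\<^bsub>AutT\<lparr>carrier := vertex_stabilizer u\<rparr>\<^esub> g)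
      = psi u f \<otimes>\<^bsub>AutT\<^esub> psi u g"
    using fg by (simp add: psi_def vertex_stabilizer_def section_at_mult)
qed

end

theory Submission
  imports Defs
begin

text \<open>
  Sections of a product obey \<open>(fg)\<^sub>u = f\<^sub>u g\<^bsub>f(u)\<^esub>\<close>. If \<open>m\<close> fixes the vertex \<open>g(u)\<close>, this gives
  \<open>(g m g\<^sup>-\<^sup>1)\<^sub>u = g\<^sub>u m\<^bsub>g(u)\<^esub> (g\<^sub>u)\<^sup>-\<^sup>1\<close>: conjugating by \<open>g\<close> permutes the sections on a level along
  the action of \<open>g\<close> and conjugates each of them by a section of \<open>g\<close>. Since \<open>G\<close> is self-similar,
  these conjugating sections lie in \<open>G\<close>, so they preserve \<open>N\<close>. Hence the elements of \<open>G\<close> that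
  fix the level \<open>L\<^sub>n\<close> pointwise and have all their sections at \<open>L\<^sub>n\<close> in \<open>N\<close> form a normal subgroup
  of \<open>G\<close> (\<open>sections_in_normal\<close>). The requirement must be imposed on all of \<open>L\<^sub>n\<close> at once: for
  a single vertex \<open>u\<close> it need not be invariant under conjugation. This normal subgroup contains
  \<open>S\<close>, and therefore it contains \<open>K\<close>.
\<close>

lemma AutT_mult_apply: "(f \<otimes>\<^bsub>AutT\<^esub> g) u = g (f u)"
  by (simp add: AutT_def)

lemma AutT_one_apply: "\<one>\<^bsub>AutT\<^esub> u = u"
  by (simp add: AutT_def)

lemma AutT_inv_apply:
  assumes "g \<in> carrier AutT"
  shows "(inv\<^bsub>AutT\<^esub> g) (g u) = u"
proof -
  have "(inv\<^bsub>AutT\<^esub> g) (g u) = (g \<otimes>\<^bsub>AutT\<^esub> inv\<^bsub>AutT\<^esub> g) u"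
    by (simp only: AutT_mult_apply)
  also have "\<dots> = u"
    by (simp only: group.r_inv[OF AutT_group assms] AutT_one_apply)
  finally show ?thesis .
qed

lemma AutT_length:
  "g \<in> carrier AutT \<Longrightarrow> length (g u) = length u"
  by (simp add: AutT_def tree_auts_length)

lemma section_at_one: "section_at \<one>\<^bsub>AutT\<^esub> u = \<one>\<^bsub>AutT\<^esub>"
  by (rule section_at_unique)
    (simp_all add: AutT_one_apply monoid.one_closed group.is_monoid AutT_group)

text \<open>
  The inverse of \<open>g\<close> carries the subtree at \<open>g(u)\<close> back to the subtree at \<open>u\<close>, so its section
  has to be taken at \<open>g(u)\<close> to undo \<open>g\<^sub>u\<close>.
\<close>

lemma section_at_inv:
  assumes g: "g \<in> carrier AutT"
  shows "section_at (inv\<^bsub>AutT\<^esub> g) (g u) = inv\<^bsub>AutT\<^esub> (section_at g u)"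
proof -
  interpret A: group AutT by (rule AutT_group)
  have "section_at g u \<otimes>\<^bsub>AutT\<^esub> section_at (inv\<^bsub>AutT\<^esub> g) (g u)
      = section_at (g \<otimes>\<^bsub>AutT\<^esub> inv\<^bsub>AutT\<^esub> g) u"
    using g by (simp only: section_at_mult A.inv_closed)
  also have "\<dots> = \<one>\<^bsub>AutT\<^esub>"
    using g by (simp only: A.r_inv section_at_one)
  finally have "section_at (inv\<^bsub>AutT\<^esub> g) (g u) \<otimes>\<^bsub>AutT\<^esub> section_at g u = \<one>\<^bsub>AutT\<^esub>"
    using g by (simp add: A.inv_comm section_at_spec(1))
  then show ?thesis
    using g by (simp add: A.inv_equality section_at_spec(1))
qed

lemma section_at_conjugate:
  assumes g: "g \<in> carrier AutT" and m: "m \<in> carrier AutT" and fixed: "m (g u) = g u"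
  shows "section_at (g \<otimes>\<^bsub>AutT\<^esub> m \<otimes>\<^bsub>AutT\<^esub> inv\<^bsub>AutT\<^esub> g) u
    = section_at g u \<otimes>\<^bsub>AutT\<^esub> section_at m (g u) \<otimes>\<^bsub>AutT\<^esub> inv\<^bsub>AutT\<^esub> (section_at g u)"
proof -
  interpret A: group AutT by (rule AutT_group)
  show ?thesis
    using g m by (simp add: section_at_mult AutT_mult_apply fixed section_at_inv)
qed

text \<open>
  The sections of a conjugate \<open>g m g\<^sup>-\<^sup>1\<close> on \<open>L\<^sub>n\<close> are \<open>G\<close>-conjugates of the sections of \<open>m\<close>
  at the vertices \<open>g(u)\<close>, which lie on \<open>L\<^sub>n\<close> again because automorphisms preserve length.
  Closure under products and inverses holds because taking the section at a fixed vertex is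
  multiplicative.
\<close>

lemma sections_in_normal:
  assumes G: "subgroup G AutT" and self: "self_similar G"
    and N: "N \<lhd> AutT\<lparr>carrier := G\<rparr>"
  shows "{m \<in> level_stabilizer G n. \<forall>u \<in> level n. section_at m u \<in> N} \<lhd> AutT\<lparr>carrier := G\<rparr>"
    (is "?M \<lhd> ?H")
proof -
  interpret A: group AutT by (rule AutT_group)
  interpret H: group ?H by (rule A.subgroup_imp_group[OF G])
  interpret N: normal N ?H by (rule N)
  have GA: "g \<in> carrier AutT" if "g \<in> G" for g
    using that subgroup.subset[OF G] by blast
  have NA: "subgroup N AutT"
    using A.incl_subgroup[OF G N.is_subgroup] .
  have inv_H: "inv\<^bsub>?H\<^esub> g = inv\<^bsub>AutT\<^esub> g" if "g \<in> G" for g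
    using A.m_inv_consistent[OF G that] .
  have N_conj: "g \<otimes>\<^bsub>AutT\<^esub> h \<otimes>\<^bsub>AutT\<^esub> inv\<^bsub>AutT\<^esub> g \<in> N" if "g \<in> G" "h \<in> N" for g h
    using N.inv_op_closed2[of g h] that inv_H by simp
  have M: "m \<in> G" "m \<in> carrier AutT" "m u = u" "section_at m u \<in> N"
    if "m \<in> ?M" "u \<in> level n" for m u
    using that GA by (auto simp: level_stabilizer_def)
  have MI: "m \<in> ?M" if "m \<in> G" "\<And>u. u \<in> level n \<Longrightarrow> m u = u \<and> section_at m u \<in> N" for m
    using that by (simp add: level_stabilizer_def)
  have MG: "?M \<subseteq> G"
    by (auto simp: level_stabilizer_def)
  have inv_M: "inv\<^bsub>AutT\<^esub> m \<in> ?M" if m: "m \<in> ?M" for m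
  proof (rule MI)
    show "inv\<^bsub>AutT\<^esub> m \<in> G"
      using m MG subgroup.m_inv_closed[OF G] by blast
    fix u :: "'a list" assume u: "u \<in> level n"
    show "(inv\<^bsub>AutT\<^esub> m) u = u \<and> section_at (inv\<^bsub>AutT\<^esub> m) u \<in> N"
      using AutT_inv_apply[of m u] section_at_inv[of m u] M[OF m u]
        subgroup.m_inv_closed[OF NA, of "section_at m u"] by simp
  qed
  have mult_M: "f \<otimes>\<^bsub>AutT\<^esub> m \<in> ?M" if f: "f \<in> ?M" and m: "m \<in> ?M" for f m
  proof (rule MI)
    show "f \<otimes>\<^bsub>AutT\<^esub> m \<in> G"
      using f m MG subgroup.m_closed[OF G] by blast
    fix u :: "'a list" assume u: "u \<in> level n"
    show "(f \<otimes>\<^bsub>AutT\<^esub> m) u = u \<and> section_at (f \<otimes>\<^bsub>AutT\<^esub> m) u \<in> N"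
      using M[OF f u] M[OF m u] subgroup.m_closed[OF NA]
      by (simp add: AutT_mult_apply section_at_mult)
  qed
  have one_M: "\<one>\<^bsub>AutT\<^esub> \<in> ?M"
    using subgroup.one_closed[OF G] subgroup.one_closed[OF NA]
    by (intro MI) (simp_all add: AutT_one_apply section_at_one)
  have "subgroup ?M ?H"
  proof (rule H.subgroupI)
    show "?M \<subseteq> carrier ?H"
      using MG by simp
    show "?M \<noteq> {}"
      using one_M by blast
    show "inv\<^bsub>?H\<^esub> m \<in> ?M" if m: "m \<in> ?M" for m
      unfolding inv_H[OF subsetD[OF MG m]] using inv_M[OF m] .
    show "f \<otimes>\<^bsub>?H\<^esub> m \<in> ?M" if f: "f \<in> ?M" and m: "m \<in> ?M" for f m
      using mult_M[OF f m] by simp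
  qed
  moreover have "g \<otimes>\<^bsub>AutT\<^esub> m \<otimes>\<^bsub>AutT\<^esub> inv\<^bsub>AutT\<^esub> g \<in> ?M" if g: "g \<in> G" and m: "m \<in> ?M" for g m
  proof (rule MI)
    show "g \<otimes>\<^bsub>AutT\<^esub> m \<otimes>\<^bsub>AutT\<^esub> inv\<^bsub>AutT\<^esub> g \<in> G"
      using g m MG by (blast intro: subgroup.m_closed[OF G] subgroup.m_inv_closed[OF G])
    fix u :: "'a list" assume u: "u \<in> level n"
    have gu: "g u \<in> level n"
      using u AutT_length[OF GA[OF g]] by (simp add: level_def)
    have "section_at g u \<in> G"
      using self g by (simp add: self_similar_def)
    then show "(g \<otimes>\<^bsub>AutT\<^esub> m \<otimes>\<^bsub>AutT\<^esub> inv\<^bsub>AutT\<^esub> g) u = u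
        \<and> section_at (g \<otimes>\<^bsub>AutT\<^esub> m \<otimes>\<^bsub>AutT\<^esub> inv\<^bsub>AutT\<^esub> g) u \<in> N"
      using M[OF m gu] GA[OF g]
      by (simp add: section_at_conjugate N_conj AutT_mult_apply AutT_inv_apply)
  qed
  ultimately show ?thesis
    by (subst H.normal_inv_iff) (simp add: inv_H)
qed

theorem lemma2p9:
  fixes G S K N :: "('x::finite list \<Rightarrow> 'x list) set" and n :: nat
  assumes "subgroup G AutT"
    and "self_similar G"
    and "S \<subseteq> G"
    and "K = normal_closure (AutT\<lparr>carrier := G\<rparr>) S"
    and "N \<lhd> AutT\<lparr>carrier := G\<rparr>"
    and "K \<subseteq> level_stabilizer G n"
    and "\<forall>u \<in> level n. psi u ` S \<subseteq> N"
  shows "\<forall>u \<in> level n. psi u ` K \<subseteq> N"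
proof -
  let ?M = "{m \<in> level_stabilizer G n. \<forall>u \<in> level n. section_at m u \<in> N}"
  have psi: "psi u m = section_at m u" if "m \<in> level_stabilizer G n" "u \<in> level n" for m u
    using that subgroup.subset[OF assms(1)]
    by (auto simp: psi_def vertex_stabilizer_def level_stabilizer_def)
  have "S \<subseteq> K"
    unfolding assms(4) normal_closure_def by blast
  have "S \<subseteq> ?M"
  proof
    fix s assume s: "s \<in> S"
    then have st: "s \<in> level_stabilizer G n"
      using \<open>S \<subseteq> K\<close> assms(6) by blast
    have "section_at s u \<in> N" if "u \<in> level n" for u
      using assms(7) s that psi[OF st that] by (metis image_subset_iff)
    then show "s \<in> ?M"
      using st by blast
  qed
  then have "K \<subseteq> ?M"
    unfolding assms(4) normal_closure_def
    using sections_in_normal[OF assms(1,2,5)] by blast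
  then show ?thesis
    using psi by auto
qed

end
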